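(* Let $X=\{0,1\}$ and let $\nu$ be the uniform Bernoulli measure on $X^{\mathbb N}$. Let $A$ be the adding machine, $A(0w)=1w$, $A(1w)=0A(w)$, and let $B$ be the lamplighter automaton with states $a,b$ and initial state $a$, where $$a(0w)=1a(w),\quad a(1w)=0b(w),\quad b(0w)=0a(w),\quad b(1w)=1b(w).$$ Then the measure $\mu_{A,B}=\mathrm{Log}_A(B)_*\nu$ is not finite-state.
   Context: For every $n$ and $w_1,w_2\in X^n$ there is an integer $k$, unique mod $2^n$, with $A^k(w_1)=w_2$. $\mathrm{Log}_{A,n}(B):X^n\to\mathbb Z/2^n\mathbb Z$ sends $w$ to the class of $k$ with $A^k(w)=B(w)$. Identifying $\mathbb Z/2^n\mathbb Z$ with $X^n$ via $w_0w_1\dots w_{n-1}\leftrightarrow\sum_i w_i2^i$, the maps $\mathrm{Log}_{A,n}(B)$ are compatible with deletion of last letters and together define $\mathrm{Log}_A(B):X^{\mathbb N}\to X^{\mathbb N}$ (whose length-$n$ prefix on input $\xi$ is $\mathrm{Log}_{A,n}(B)$ of the length-$n$ prefix of $\xi$). $wX^{\mathbb N}$ denotes the cylinder of infinite words with prefix $w$; $\nu(wX^{\mathbb N})=2^{-|w|}$; $g_*\nu(E)=\nu(g^{-1}(E))$. For a probability measure $\mu$ on $X^{\mathbb N}$ and a finite word $w$, the section $\mu|_w$ is the probability measure with $\mu|_w(vX^{\mathbb N})=\mu(wvX^{\mathbb N})/\mu(wX^{\mathbb N})$ if $\mu(wX^{\mathbb N})\neq0$, and the null measure otherwise. $\mu$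 is finite-state if it has only finitely many distinct sections. *)

theory Defs
  imports "HOL-Probability.Probability"
begin

text \<open>
  The alphabet is \<^typ>\<open>bool\<close>, with \<^const>\<open>False\<close> for the letter 0 and \<^const>\<open>True\<close> for the
  letter 1. Finite words are lists and infinite words are streams; \<^term>\<open>stake n \<xi>\<close> is the
  prefix of length \<open>n\<close> of \<open>\<xi>\<close>.
\<close>

fun adding :: "bool list \<Rightarrow> bool list" where
  "adding [] = []"
| "adding (False # w) = True # w"
| "adding (True # w) = False # adding w"

datatype lamp_state = St_a | St_b

fun lamplighter :: "lamp_state \<Rightarrow> bool list \<Rightarrow> bool list" where
  "lamplighter q [] = []"
| "lamplighter St_a (False # w) = True # lamplighter St_a w"
| "lamplighter St_a (True # w) = False # lamplighter St_b w"
| "lamplighter St_b (False # w) = False # lamplighter St_a w"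
| "lamplighter St_b (True # w) = True # lamplighter St_b w"

text \<open>
  Residue classes modulo \<open>2 ^ n\<close> are represented by their unique element \<open>k < 2 ^ n\<close>; that this
  determines \<open>k\<close> when \<open>A\<close> is the adding machine is \<open>adding_ex1\<close> below, and \<open>adding_power_eq_iff\<close>
  shows that exactly the congruent exponents have the same effect.
\<close>

definition Log_fin :: "(bool list \<Rightarrow> bool list) \<Rightarrow> (bool list \<Rightarrow> bool list) \<Rightarrow> bool list \<Rightarrow> nat" where
  "Log_fin A B w = (THE k. k < 2 ^ length w \<and> (A ^^ k) w = B w)"

text \<open>Inverse of the identification of \<open>w\<^sub>0 w\<^sub>1 \<dots> w\<^sub>n\<^sub>-\<^sub>1\<close> with \<open>\<Sum>i. w\<^sub>i 2\<^sup>i\<close>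
  (see \<open>residue_word_eq_iff\<close>).\<close>

definition residue_word :: "nat \<Rightarrow> nat \<Rightarrow> bool list" where
  "residue_word n k = map (bit k) [0..<n]"

definition Log :: "(bool list \<Rightarrow> bool list) \<Rightarrow> (bool list \<Rightarrow> bool list) \<Rightarrow> bool stream \<Rightarrow> bool stream" where
  "Log A B \<xi> = (THE \<zeta>. \<forall>n. stake n \<zeta> = residue_word n (Log_fin A B (stake n \<xi>)))"

abbreviation words :: "bool stream measure" where
  "words \<equiv> stream_space (count_space UNIV)"

definition cylinder :: "bool list \<Rightarrow> bool stream set" where
  "cylinder w = {\<xi>. stake (length w) \<xi> = w}"

definition bernoulli_measure :: "bool stream measure" where
  "bernoulli_measure = stream_space (measure_pmf (pmf_of_set UNIV))"

text \<open>For a probability measure \<open>\<mu>\<close>, \<open>meas_section_cylinder\<close> below shows that the description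
  determines a measure.\<close>

definition meas_section :: "bool stream measure \<Rightarrow> bool list \<Rightarrow> bool stream measure" where
  "meas_section \<mu> w =
    (if measure \<mu> (cylinder w) \<noteq> 0
     then (THE \<kappa>. prob_space \<kappa> \<and> sets \<kappa> = sets words \<and>
             (\<forall>v. measure \<kappa> (cylinder v) = measure \<mu> (cylinder (w @ v)) / measure \<mu> (cylinder w)))
     else null_measure words)"

definition finite_state :: "bool stream measure \<Rightarrow> bool" where
  "finite_state \<mu> \<longleftrightarrow> finite (range (meas_section \<mu>))"

definition log_measure :: "(bool list \<Rightarrow> bool list) \<Rightarrow> (bool list \<Rightarrow> bool list) \<Rightarrow> bool stream measure" where
  "log_measure A B = distr bernoulli_measure words (Log A B)"


subsection \<open>Well-definedness of the discrete logarithm\<close>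

abbreviation word_val :: "bool list \<Rightarrow> nat" where
  "word_val \<equiv> horner_sum of_bool 2"

lemma word_val_less: "word_val w < 2 ^ length w"
  by (induction w) auto

lemma residue_word_word_val: "residue_word (length w) (word_val w) = w"
  by (rule nth_equalityI) (auto simp: residue_word_def bit_horner_sum_bit_iff)

lemma residue_word_eq_iff:
  assumes "length w = n" "k < 2 ^ n"
  shows "residue_word n k = w \<longleftrightarrow> k = (\<Sum>i<n. of_bool (w ! i) * 2 ^ i)"
proof -
  have "word_val (residue_word n k) = k"
    using assms by (simp add: residue_word_def horner_sum_bit_eq_take_bit take_bit_nat_eq_self)
  moreover have "word_val w = (\<Sum>i<n. of_bool (w ! i) * 2 ^ i)"
    using assms by (simp add: horner_sum_eq_sum lessThan_atLeast0)
  ultimately show ?thesis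
    using residue_word_word_val[of w] assms(1) by metis
qed

lemma word_val_inj: "length v = length w \<Longrightarrow> word_val v = word_val w \<Longrightarrow> v = w"
  by (metis residue_word_word_val)

lemma length_adding [simp]: "length (adding w) = length w"
  by (induction w rule: adding.induct) auto

lemma length_lamplighter [simp]: "length (lamplighter q w) = length w"
  by (induction q w rule: lamplighter.induct) auto

lemma take_adding: "take n (adding w) = adding (take n w)"
proof (induction w arbitrary: n rule: adding.induct)
  case (2 w) then show ?case by (cases n) auto
next
  case (3 w) then show ?case by (cases n) auto
qed auto

lemma take_lamplighter: "take n (lamplighter q w) = lamplighter q (take n w)"
proof (induction q w arbitrary: n rule: lamplighter.induct)
  case (1 q) then show ?case by simp
next
  case (2 w) then show ?case by (cases n) auto
next
  case (3 w) then show ?case by (cases n) auto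
next
  case (4 w) then show ?case by (cases n) auto
next
  case (5 w) then show ?case by (cases n) auto
qed

lemma word_val_adding: "word_val (adding w) = (word_val w + 1) mod 2 ^ length w"
proof (induction w rule: adding.induct)
  case (2 w)
  then show ?case using word_val_less[of w] by simp
next
  case (3 w)
  have "(word_val (True # w) + 1) mod 2 ^ length (True # w)
      = (2 * (word_val w + 1)) mod (2 * 2 ^ length w)"
    by simp
  also have "\<dots> = 2 * ((word_val w + 1) mod 2 ^ length w)"
    by (simp only: mod_mult_mult1)
  finally show ?case using 3 by simp
qed simp

lemma length_adding_power [simp]: "length ((adding ^^ k) w) = length w"
  by (induction k) auto

lemma word_val_adding_power: "word_val ((adding ^^ k) w) = (word_val w + k) mod 2 ^ length w"
proof (induction k)
  case 0
  then show ?case by (simp add: word_val_less)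
next
  case (Suc k)
  then show ?case by (simp add: word_val_adding mod_simps)
qed

lemma adding_power_eq_iff:
  "(adding ^^ k) w = (adding ^^ l) w \<longleftrightarrow> k mod 2 ^ length w = l mod 2 ^ length w"
proof -
  have "(adding ^^ k) w = (adding ^^ l) w \<longleftrightarrow>
      (word_val w + k) mod 2 ^ length w = (word_val w + l) mod 2 ^ length w"
    by (metis word_val_adding_power word_val_inj length_adding_power)
  also have "\<dots> \<longleftrightarrow> k mod 2 ^ length w = l mod 2 ^ length w"
    unfolding of_nat_eq_iff[where 'a = int, symmetric] zmod_int mod_eq_dvd_iff by simp
  finally show ?thesis .
qed

lemma adding_ex1:
  assumes "length v = length w"
  shows "\<exists>!k. k < 2 ^ length w \<and> (adding ^^ k) w = v"
proof (rule ex_ex1I)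
  let ?m = "2 ^ length w :: nat"
  let ?k = "word_val v + (?m - word_val w)"
  have "word_val ((adding ^^ ?k) w) = (word_val v + ?m) mod ?m"
    using word_val_less[of w] by (simp add: word_val_adding_power)
  also have "\<dots> = word_val v"
    using word_val_less[of v] assms by simp
  finally have "(adding ^^ ?k) w = v"
    by (intro word_val_inj) (auto simp: assms)
  moreover have "(adding ^^ (?k mod ?m)) w = (adding ^^ ?k) w"
    by (subst adding_power_eq_iff) simp
  ultimately show "\<exists>k. k < ?m \<and> (adding ^^ k) w = v"
    by (intro exI[of _ "?k mod ?m"]) simp
qed (metis adding_power_eq_iff mod_less)

lemma Log_fin_adding:
  assumes "length (B w) = length w"
  shows "Log_fin adding B w < 2 ^ length w" "(adding ^^ Log_fin adding B w) w = B w"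
  using theI'[OF adding_ex1[of "B w" w, OF assms]] by (auto simp: Log_fin_def)

lemma take_adding_power: "take n ((adding ^^ k) w) = (adding ^^ k) (take n w)"
  by (induction k) (auto simp: take_adding)

lemma Log_fin_take:
  assumes len: "\<And>w. length (B w) = length w" and tk: "\<And>n w. take n (B w) = B (take n w)"
    and "n \<le> length w"
  shows "Log_fin adding B (take n w) = Log_fin adding B w mod 2 ^ n"
proof -
  have "(adding ^^ Log_fin adding B (take n w)) (take n w) = (adding ^^ Log_fin adding B w) (take n w)"
    by (metis Log_fin_adding(2) len take_adding_power tk)
  then show ?thesis
    using Log_fin_adding(1)[of B "take n w"] assms by (simp add: adding_power_eq_iff len)
qed

lemma stake_Log:
  assumes len: "\<And>w. length (B w) = length w" and tk: "\<And>n w. take n (B w) = B (take n w)"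
  shows "stake n (Log adding B \<xi>) = residue_word n (Log_fin adding B (stake n \<xi>))"
proof -
  let ?f = "\<lambda>n. residue_word n (Log_fin adding B (stake n \<xi>))"
  have len_f: "length (?f n) = n" for n
    by (simp add: residue_word_def)
  have compat: "?f m ! i = ?f (Suc i) ! i" if "i < m" for i m
  proof -
    have "Log_fin adding B (stake (Suc i) \<xi>) = Log_fin adding B (stake m \<xi>) mod 2 ^ Suc i"
      using Log_fin_take[OF len tk, of "Suc i" "stake m \<xi>"] that
      by (simp add: take_stake min_def del: stake.simps)
    then show ?thesis
      using that by (simp add: residue_word_def bit_take_bit_iff flip: take_bit_eq_mod del: stake.simps upt_Suc power_Suc)
  qed
  have "\<exists>!\<zeta>. \<forall>n. stake n \<zeta> = ?f n"
  proof (rule ex_ex1I)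
    let ?z = "smap (\<lambda>i. ?f (Suc i) ! i) nats"
    have "stake n ?z = ?f n" for n
    proof (rule nth_equalityI)
      fix i assume "i < length (stake n ?z)"
      then have "i < n" by simp
      then show "stake n ?z ! i = ?f n ! i"
        using compat[of i n] by (simp add: stake_nth del: stake.simps)
    qed (simp add: len_f)
    then show "\<exists>\<zeta>. \<forall>n. stake n \<zeta> = ?f n" by blast
  next
    fix y z assume y: "\<forall>n. stake n y = ?f n" and z: "\<forall>n. stake n z = ?f n"
    have "y !! i = z !! i" for i
      using stake_nth[of i "Suc i" y] stake_nth[of i "Suc i" z] y z by simp
    then have "(!!) y = (!!) z" by blast
    then show "y = z"
      by (metis stream_smap_nats)
  qed
  from theI'[OF this] show ?thesis
    unfolding Log_def by blast
qed


subsection \<open>Cylinders, measurability and sections\<close>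

lemma cylinder_eq_sstart: "cylinder w = sstart UNIV w"
proof -
  have "\<xi> \<in> cylinder w \<longleftrightarrow> \<xi> \<in> sstart UNIV w" for \<xi>
    by (subst sstart_eq) (auto simp: cylinder_def list_eq_iff_nth_eq stake_nth)
  then show ?thesis by blast
qed

lemma cylinder_append: "cylinder (w @ v) = cylinder w \<inter> sdrop (length w) -` cylinder v"
proof -
  have "stake (length (w @ v)) \<xi> = w @ v \<longleftrightarrow>
      stake (length w) \<xi> = w \<and> stake (length v) (sdrop (length w) \<xi>) = v" for \<xi>
    unfolding length_append stake_add[symmetric] by (rule append_eq_append_conv) simp
  then show ?thesis
    by (simp only: cylinder_def) blast
qed

lemma sets_cylinder [measurable]: "cylinder w \<in> sets words"
  by (simp add: cylinder_eq_sstart sstart_sets)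

lemma sets_bernoulli_measure [measurable_cong, simp]: "sets bernoulli_measure = sets words"
  unfolding bernoulli_measure_def by (rule sets_stream_space_cong) simp

lemma prob_space_bernoulli_measure: "prob_space bernoulli_measure"
  unfolding bernoulli_measure_def
  by (rule prob_space.prob_space_stream_space) (rule prob_space_measure_pmf)

lemma emeasure_bernoulli_cylinder: "emeasure bernoulli_measure (cylinder w) = ennreal ((1/2) ^ length w)"
proof (induction w)
  case Nil
  interpret prob_space bernoulli_measure by (rule prob_space_bernoulli_measure)
  have "cylinder [] = space bernoulli_measure"
    using sets_eq_imp_space_eq[OF sets_bernoulli_measure]
    by (auto simp: cylinder_def space_stream_space)
  then show ?case by (simp add: emeasure_space_1)
next
  case (Cons x w)
  let ?P = "measure_pmf (pmf_of_set UNIV) :: bool measure"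
  have "emeasure bernoulli_measure (cylinder (x # w)) =
      (\<integral>\<^sup>+t. emeasure bernoulli_measure {\<xi> \<in> space bernoulli_measure. t ## \<xi> \<in> cylinder (x # w)} \<partial>?P)"
    unfolding bernoulli_measure_def
    by (rule prob_space.emeasure_stream_space[OF prob_space_measure_pmf])
       (metis sets_cylinder bernoulli_measure_def sets_bernoulli_measure)
  also have "\<dots> = (\<integral>\<^sup>+t. ennreal ((1/2) ^ length w) * indicator {x} t \<partial>?P)"
  proof (rule nn_integral_cong)
    fix t
    have "space bernoulli_measure = UNIV"
      using sets_eq_imp_space_eq[OF sets_bernoulli_measure] by (simp add: space_stream_space)
    then have "{\<xi> \<in> space bernoulli_measure. t ## \<xi> \<in> cylinder (x # w)} = (if t = x then cylinder w else {})"
      by (auto simp: cylinder_def)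
    then show "emeasure bernoulli_measure {\<xi> \<in> space bernoulli_measure. t ## \<xi> \<in> cylinder (x # w)} =
        ennreal ((1/2) ^ length w) * indicator {x} t"
      using Cons by (simp split: split_indicator)
  qed
  also have "\<dots> = ennreal ((1/2) ^ length w) * ennreal (1/2)"
    by (simp add: nn_integral_cmult_indicator emeasure_pmf_single)
  also have "\<dots> = ennreal ((1/2) ^ length (x # w))"
    by (subst ennreal_mult[symmetric]) (auto simp: mult.commute)
  finally show ?case .
qed

lemma measurable_Log [measurable]:
  assumes len: "\<And>w. length (B w) = length w" and tk: "\<And>n w. take n (B w) = B (take n w)"
  shows "Log adding B \<in> measurable words words"
proof (rule measurable_stream_space2)
  fix n
  have "Log adding B \<xi> !! n = residue_word (Suc n) (Log_fin adding B (stake (Suc n) \<xi>)) ! n" for \<xi>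
    using stake_Log[OF len tk, of "Suc n" \<xi>] stake_nth[of n "Suc n" "Log adding B \<xi>"] by simp
  then show "(\<lambda>\<xi>. Log adding B \<xi> !! n) \<in> measurable words (count_space UNIV)"
    by (simp del: stake.simps)
qed

lemma prob_space_log_measure: "prob_space (log_measure adding (lamplighter q))"
  unfolding log_measure_def
proof (rule prob_space.prob_space_distr[OF prob_space_bernoulli_measure])
  have "Log adding (lamplighter q) \<in> measurable words words"
    by (rule measurable_Log) (auto simp: take_lamplighter)
  then show "Log adding (lamplighter q) \<in> measurable bernoulli_measure words"
    by simp
qed

lemma sets_log_measure [simp]: "sets (log_measure A B) = sets words"
  by (simp add: log_measure_def)

lemma words_measure_eqI:
  assumes "prob_space M" "prob_space N" "sets M = sets words" "sets N = sets words"
    and eq: "\<And>v. measure M (cylinder v) = measure N (cylinder v)"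
  shows "M = N"
proof (rule stream_space_eq_sstart[of UNIV])
  interpret M: prob_space M by fact
  interpret N: prob_space N by fact
  show "emeasure M (sstart UNIV v) = emeasure N (sstart UNIV v)" for v
    using eq[of v] by (simp add: M.emeasure_eq_measure N.emeasure_eq_measure cylinder_eq_sstart)
qed (use assms in auto)

lemma meas_section_cylinder:
  assumes "prob_space \<mu>" and sets_mu: "sets \<mu> = sets words" and nz: "measure \<mu> (cylinder w) \<noteq> 0"
  shows "prob_space (meas_section \<mu> w)" and "sets (meas_section \<mu> w) = sets words"
    and "measure (meas_section \<mu> w) (cylinder v) = measure \<mu> (cylinder (w @ v)) / measure \<mu> (cylinder w)"
proof -
  interpret prob_space \<mu> by fact
  let ?Q = "\<lambda>\<kappa>. prob_space \<kappa> \<and> sets \<kappa> = sets words \<and>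
    (\<forall>v. measure \<kappa> (cylinder v) = measure \<mu> (cylinder (w @ v)) / measure \<mu> (cylinder w))"
  let ?U = "uniform_measure \<mu> (cylinder w)"
  let ?k = "distr ?U words (sdrop (length w))"
  have [measurable_cong]: "sets ?U = sets words" by (simp add: sets_mu)
  have [measurable]: "sdrop (length w) \<in> measurable ?U words" by simp
  have em: "emeasure \<mu> (cylinder w) \<noteq> 0" "emeasure \<mu> (cylinder w) \<noteq> \<infinity>"
    using nz by (auto simp: emeasure_eq_measure)
  interpret U: prob_space ?U by (rule prob_space_uniform_measure[OF em])
  have "measure ?k (cylinder v) = measure \<mu> (cylinder (w @ v)) / measure \<mu> (cylinder w)" for v
  proof -
    have sp: "space \<mu> = UNIV"
      using sets_eq_imp_space_eq[OF sets_mu] by (simp add: space_stream_space)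
    have "sdrop (length w) -` cylinder v \<inter> space ?U \<in> sets \<mu>"
      using measurable_sets[of "sdrop (length w)" ?U words "cylinder v"] by simp
    moreover have "cylinder w \<inter> (sdrop (length w) -` cylinder v \<inter> space ?U) = cylinder (w @ v)"
      unfolding cylinder_append sp space_uniform_measure by auto
    ultimately show ?thesis
      using sets_cylinder[of w] em
      by (simp add: measure_distr sp measure_uniform_measure)
  qed
  then have "?Q ?k"
    by (auto intro!: U.prob_space_distr)
  moreover have "\<kappa> = \<kappa>'" if "?Q \<kappa>" "?Q \<kappa>'" for \<kappa> \<kappa>'
    using that by (intro words_measure_eqI) auto
  ultimately have "\<exists>!\<kappa>. ?Q \<kappa>"
    by blast
  from theI'[OF this] have "?Q (meas_section \<mu> w)"
    using nz by (simp add: meas_section_def)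
  then show "prob_space (meas_section \<mu> w)" "sets (meas_section \<mu> w) = sets words"
    "measure (meas_section \<mu> w) (cylinder v) = measure \<mu> (cylinder (w @ v)) / measure \<mu> (cylinder w)"
    by auto
qed

end

theory Submission
  imports Defs
begin

text \<open>
  A word \<open>w\<close> of length \<open>n\<close> has logarithm \<open>1\<^sup>n\<close>, that is \<open>- 1\<close> modulo \<open>2 ^ n\<close>, iff \<open>A (B w) = w\<close>.
  Reading this equation letter by letter, one sees that it has exactly \<open>2 n\<close> solutions for
  \<open>n \<ge> 1\<close>. Hence \<open>\<mu>(1\<^sup>n X\<^sup>\<nat>) = 2 n / 2 ^ n\<close>, and the section at \<open>1\<^sup>n\<close> gives the cylinder of the
  word \<open>1\<close> the mass \<open>(n + 1) / (2 n)\<close>; these masses are pairwise distinct.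
\<close>

text \<open>Prefixes of \<open>Log\<close> depend only on prefixes of the input, so the preimage of
  a cylinder is a disjoint union of cylinders of the same depth, each of mass
  \<open>(1/2) ^ length v\<close>.\<close>

lemma measure_log_measure_cylinder:
  assumes len: "\<And>w. length (B w) = length w" and tk: "\<And>n w. take n (B w) = B (take n w)"
  shows "measure (log_measure adding B) (cylinder v) =
    card {w. length w = length v \<and> residue_word (length v) (Log_fin adding B w) = v} / 2 ^ length v"
    (is "_ = card ?S / _")
proof -
  interpret prob_space bernoulli_measure by (rule prob_space_bernoulli_measure)
  have space: "space bernoulli_measure = UNIV"
    using sets_eq_imp_space_eq[OF sets_bernoulli_measure] by (simp add: space_stream_space)
  have "Log adding B \<in> measurable bernoulli_measure words"
    using measurable_Log[OF len tk] by simp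
  then have "measure (log_measure adding B) (cylinder v) = prob (Log adding B -` cylinder v)"
    by (simp add: log_measure_def measure_distr space)
  also have "Log adding B -` cylinder v = (\<Union>w\<in>?S. cylinder w)"
    by (auto simp: cylinder_def stake_Log[OF len tk])
  also have "prob \<dots> = (\<Sum>w\<in>?S. prob (cylinder w))"
  proof (rule finite_measure_finite_Union)
    show "finite ?S"
      using finite_lists_length_eq[of "UNIV :: bool set" "length v"]
      by (rule finite_subset[rotated]) auto
    show "disjoint_family_on cylinder ?S"
      by (auto simp: disjoint_family_on_def cylinder_def)
  qed auto
  also have "\<dots> = (\<Sum>w\<in>?S. (1 / 2) ^ length v)"
    by (intro sum.cong) (auto simp: measure_def emeasure_bernoulli_cylinder)
  finally show ?thesis
    by (simp add: power_divide)
qed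

lemma residue_word_eq_replicate_True_iff:
  assumes "k < 2 ^ n"
  shows "residue_word n k = replicate n True \<longleftrightarrow> Suc k = 2 ^ n"
proof -
  have "residue_word n k = replicate n True \<longleftrightarrow> k = (\<Sum>i<n. 2 ^ i)"
    using residue_word_eq_iff[of "replicate n True" n k] assms by simp
  moreover have "Suc (\<Sum>i<n. 2 ^ i) = 2 ^ n"
    by (induction n) auto
  ultimately show ?thesis
    by linarith
qed

text \<open>Since \<open>B w\<close> is the \<open>?k\<close>-th iterate of \<open>adding\<close> at
  \<open>w\<close>, one more application of \<open>adding\<close> gives exponent
  \<open>Suc ?k\<close>.\<close>

lemma residue_word_Log_fin_eq_replicate_True_iff:
  assumes "length (B w) = length w"
  shows "residue_word (length w) (Log_fin adding B w) = replicate (length w) True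
    \<longleftrightarrow> adding (B w) = w"
proof -
  let ?k = "Log_fin adding B w"
  note k = Log_fin_adding[of B w, OF assms]
  have "adding (B w) = w \<longleftrightarrow> (adding ^^ Suc ?k) w = (adding ^^ 0) w"
    by (simp add: k(2))
  also have "\<dots> \<longleftrightarrow> 2 ^ length w dvd Suc ?k"
    unfolding adding_power_eq_iff by (simp add: mod_eq_0_iff_dvd)
  \<comment> \<open>\<open>Suc ?k\<close> lies between 1 and the modulus, so the modulus is its only
    possible multiple.\<close>
  also have "\<dots> \<longleftrightarrow> Suc ?k = 2 ^ length w"
    using k(1) by (auto dest: dvd_imp_le)
  finally show ?thesis
    using residue_word_eq_replicate_True_iff[OF k(1)] by simp
qed

text \<open>Turns a letter-by-letter reading of an equation on words into a recurrence for its
  number of solutions.\<close>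

lemma card_words_Suc:
  fixes P :: "bool list \<Rightarrow> bool"
  shows "card {w. length w = Suc n \<and> P w} =
    card {w. length w = n \<and> P (False # w)} + card {w. length w = n \<and> P (True # w)}"
proof -
  have fin: "finite {w :: bool list. length w = n \<and> Q w}" for Q
    using finite_lists_length_eq[of "UNIV :: bool set" n] by (rule finite_subset[rotated]) auto
  have "{w. length w = Suc n \<and> P w} =
      (#) False ` {w. length w = n \<and> P (False # w)} \<union> (#) True ` {w. length w = n \<and> P (True # w)}"
    by (auto simp: length_Suc_conv image_iff) (metis (full_types))
  then show ?thesis
    by (simp only:, subst card_Un_disjoint) (auto simp: card_image fin)
qed

text \<open>State \<open>St_a\<close> always flips the first letter.\<close>

lemma lamplighter_St_a_fixed_iff: "lamplighter St_a w = w \<longleftrightarrow> w = []"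
  by (cases "(St_a, w)" rule: lamplighter.cases) auto

text \<open>A letter 0 leads to \<open>St_a\<close>, so it can only come last: the solutions are
  \<open>1...11\<close> and \<open>1...10\<close>.\<close>

lemma card_lamplighter_St_b_fixed: "card {w. length w = Suc n \<and> lamplighter St_b w = w} = 2"
proof (induction n)
  case 0
  have "{w :: bool list. w = [] \<and> Q w} = (if Q [] then {[]} else {})" for Q
    by auto
  then show ?case
    by (simp add: card_words_Suc)
next
  case (Suc n)
  have "{w. length w = Suc n \<and> lamplighter St_a w = w} = {}"
    by (auto simp: lamplighter_St_a_fixed_iff)
  then have "card {w. length w = Suc n \<and> lamplighter St_a w = w} = 0"
    by (simp only: card.empty)
  with Suc show ?case
    by (subst card_words_Suc) simp
qed

text \<open>After a first letter 0 the same equation remains for the tail; after 1 the carry is gone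
  and the tail must be fixed by \<open>St_b\<close>. So each further letter adds 2 solutions. The
  count starts at length 1, as the empty word is itself a solution.\<close>

lemma card_adding_lamplighter_fixed:
  "card {w. length w = Suc n \<and> adding (lamplighter St_a w) = w} = 2 * Suc n"
proof (induction n)
  case 0
  have "{w :: bool list. w = [] \<and> Q w} = (if Q [] then {[]} else {})" for Q
    by auto
  then show ?case
    by (simp add: card_words_Suc)
next
  case (Suc n)
  then show ?case
    by (subst card_words_Suc) (simp add: card_lamplighter_St_b_fixed)
qed

lemma measure_log_measure_cylinder_replicate_True:
  "measure (log_measure adding (lamplighter St_a)) (cylinder (replicate (Suc n) True)) =
    2 * Suc n / 2 ^ Suc n"
proof -
  have "{w. length w = Suc n \<and>
        residue_word (Suc n) (Log_fin adding (lamplighter St_a) w) = replicate (Suc n) True} =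
      {w. length w = Suc n \<and> adding (lamplighter St_a w) = w}"
    using residue_word_Log_fin_eq_replicate_True_iff[of "lamplighter St_a"]
    by (metis (no_types, lifting) length_lamplighter)
  then show ?thesis
    by (subst measure_log_measure_cylinder)
      (simp_all only: length_lamplighter take_lamplighter length_replicate card_adding_lamplighter_fixed
        of_nat_mult of_nat_numeral)
qed

theorem corollary8p9:
  shows "\<not> finite_state (log_measure adding (lamplighter St_a))"
proof
  let ?mu = "log_measure adding (lamplighter St_a)"
  let ?section = "\<lambda>n. meas_section ?mu (replicate (Suc n) True)"
  have ratio: "measure (?section n) (cylinder [True]) = 1 / 2 + 1 / (2 * Suc n)" for n
  proof -
    \<comment> \<open>Excludes the null measure as section, so the quotient formula applies.\<close>
    have "measure ?mu (cylinder (replicate (Suc n) True)) \<noteq> 0"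
      unfolding measure_log_measure_cylinder_replicate_True by simp
    then have "measure (?section n) (cylinder [True]) =
        measure ?mu (cylinder (replicate (Suc (Suc n)) True)) /
        measure ?mu (cylinder (replicate (Suc n) True))"
      by (subst meas_section_cylinder(3)[OF prob_space_log_measure])
        (simp_all add: replicate_append_same)
    \<comment> \<open>The ratio \<open>(n + 2) / (2 * (n + 1))\<close> is split so that
      \<open>n\<close> occurs once, which makes injectivity evident.\<close>
    also have "\<dots> = 1 / 2 + 1 / (2 * Suc n)"
      unfolding measure_log_measure_cylinder_replicate_True by (simp add: divide_simps) (simp add: algebra_simps)
    finally show ?thesis .
  qed
  have "inj ?section"
  proof (rule injI)
    fix m n
    assume "?section m = ?section n"
    then have "1 / 2 + 1 / (2 * real (Suc m)) = 1 / 2 + 1 / (2 * real (Suc n))"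
      using ratio[of m] ratio[of n] by simp
    then show "m = n"
      by simp
  qed
  moreover assume "finite_state ?mu"
  then have "finite (range ?section)"
    unfolding finite_state_def by (rule finite_subset[rotated]) auto
  ultimately show False
    by (simp add: finite_image_iff)
qed

end
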